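(* Let $m$ be an odd positive integer and let $f(x)=x^{-48}+x^{20}+x^3$. Then $f$ induces a $(0,1,4)$-map over $\mathbb{F}_{2^m}$, and furthermore $|D(f)^*|=2^{m-1}$.
   Context: $f$ is regarded as a function on $\mathbb{F}_{2^m}$ with values in $\mathbb{F}_{2^m}$, with the convention $f(0)=0$ (i.e. negative powers of $0$ are $0$). A function $F:X\to Y$ is called a $(0,1,a)$-map if for every $y\in Y$ the number of $x\in X$ with $F(x)=y$ belongs to $\{0,1,a\}$. $D(f)^*=\{f(x):x\in\mathbb{F}_{2^m}^*\}\setminus\{0\}$. *)

theory Defs
  imports Complex_Main "HOL-Library.FuncSet" "HOL-Library.Cardinality"
begin

text \<open>Finiteness of the fibres is required because \<^const>\<open>card\<close> of an infinite set is \<open>0\<close>.\<close>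

definition zero_one_map :: "nat \<Rightarrow> 'a set \<Rightarrow> 'b set \<Rightarrow> ('a \<Rightarrow> 'b) \<Rightarrow> bool" where
  "zero_one_map a X Y F \<longleftrightarrow>
     F \<in> X \<rightarrow> Y \<and>
     (\<forall>y\<in>Y. finite {x \<in> X. F x = y} \<and> card {x \<in> X. F x = y} \<in> {0, 1, a})"

text \<open>Since \<open>inverse 0 = 0\<close>, we have \<open>0 powi (-48) = 0\<close>, which is the usual convention for
  negative powers of zero on a finite field.\<close>

definition trinomial :: "'a::field \<Rightarrow> 'a" where
  "trinomial x = x powi (-48) + x ^ 20 + x ^ 3"

definition D_star :: "('a::zero \<Rightarrow> 'a) \<Rightarrow> 'a set" where
  "D_star f = {f x | x. x \<noteq> 0} - {0}"

end

theory Submission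
  imports Defs "HOL-Library.Product_Plus" "HOL-Combinatorics.Cycles"
begin

text \<open>
  Let \<open>K\<close> be the field with \<open>2 ^ m\<close> elements, \<open>\<sigma>\<close> its automorphism \<open>z \<mapsto> z ^ 4\<close>, and \<open>f\<close> the
  trinomial. The key identity lives in the ring of additive polynomials: for \<open>x \<noteq> 0\<close> the operator
  \<open>\<sigma>\<^sup>2 + x \<sigma> + x\<^bsup>-3\<^esup>\<close> is a right factor of \<open>\<sigma>\<^sup>4 + y \<sigma>\<^sup>2 + 1\<close> exactly when \<open>y = f x\<close>
  (\<open>in_full_kernel_iff\<close> has the explicit left factor). In terms of
  semilinear maps this says that the nonzero solutions \<open>x\<close> of \<open>f x = y\<close> are the \<open>\<sigma>\<close>-semilinear
  square roots \<open>\<Psi>\<close> of the \<open>\<sigma>\<^sup>2\<close>-semilinear map \<open>\<Phi>\<close> of \<open>K\<^sup>2\<close> with companion matrix of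
  \<open>T\<^sup>2 + y T + 1\<close>. As \<open>m\<close> is odd, both automorphisms generate the Galois group of \<open>K\<close> over its
  prime field, and by descent \<open>\<Phi>\<close> is described by a conjugacy class of \<open>SL\<^sub>2(2)\<close>, the symmetric
  group on three letters. In this group the identity has four square roots, an involution none, and
  an element of order three exactly one; hence the fibre sizes \<open>4\<close>, \<open>0\<close> and \<open>1\<close>.

  The proof below makes this elementary. The class is read off from the set \<open>V\<close> of zeros in \<open>K\<close> of
  \<open>z ^ 256 + y * z ^ 16 + z\<close> (the fixed vectors of \<open>\<Phi>\<close>), which has \<open>4\<close>, \<open>2\<close> or \<open>1\<close> elements in the
  three cases. If \<open>V\<close> has two elements there is no \<open>x\<close> (\<open>card_full_kernel_trinomial_neq_2\<close>); if it
  has four there are at most four (\<open>card_preimage_le_4\<close>), which can be written down from a basis of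
  \<open>V\<close>; if it has one, there is at most one (\<open>trinomial_inj_on_trivial_kernel\<close>), because then \<open>\<Psi>\<close>
  has odd order and is a power of \<open>\<Psi>\<^sup>2 = \<Phi>\<close>. These upper bounds add up to exactly \<open>2 ^ m - 1\<close>,
  the number of all nonzero \<open>x\<close>, so they are attained (\<open>card_nonzero_preimage\<close>). The value \<open>0\<close>
  belongs to the two-element case, so the set of nonzero values is the complement of the set of \<open>y\<close>
  with two zeros, and the latter has \<open>2 ^ (m - 1)\<close> elements (\<open>card_full_kernel_eq_2\<close>).
\<close>

section \<open>Fields of odd degree over the field with two elements\<close>

lemma power_card_eq_same:
  fixes x :: "'a::{field,finite}"
  shows "x ^ CARD('a) = x"
proof (cases "x = 0")
  case False
  define U where "U = UNIV - {0 :: 'a}"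
  have "bij_betw ((*) x) U U"
    unfolding U_def using False
    by (intro bij_betw_byWitness[where f' = "\<lambda>y. y / x"]) auto
  then have "(\<Prod>y\<in>U. x * y) = \<Prod>U"
    by (rule prod.reindex_bij_betw)
  moreover have "(\<Prod>y\<in>U. x * y) = x ^ card U * \<Prod>U"
    by (simp add: prod.distrib)
  moreover have "\<Prod>U \<noteq> 0"
    by (simp add: U_def)
  ultimately have "x ^ card U = 1"
    by simp
  moreover have "CARD('a) = Suc (card U)"
    by (simp add: U_def card_Diff_singleton)
  ultimately show ?thesis by simp
qed (simp add: card_gt_0_iff)

locale odd_degree_binary_field =
  fixes field_type :: "'a::{field,finite} itself" and m :: nat
  assumes odd_degree: "odd m" and card_field: "CARD('a) = 2 ^ m"
begin

lemma power_order: "(x::'a) ^ 2 ^ m = x"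
  using power_card_eq_same[of x] by (simp add: card_field)

lemma two_eq_0: "(2::'a) = 0"
proof -
  have "(- 1 :: 'a) = (- 1) ^ 2 ^ m" by (simp only: power_order)
  also have "\<dots> = 1" using odd_pos[OF odd_degree] by simp
  finally show ?thesis by (metis add.right_inverse one_add_one)
qed

lemma add_self [simp]: "a + a = (0::'a)"
  by (metis mult_2 mult_zero_left two_eq_0)

lemma add_self_left [simp]: "a + (a + b) = (b::'a)"
  by (simp flip: add.assoc)

lemma add_eq_0_iff_eq: "a + b = 0 \<longleftrightarrow> a = (b::'a)"
  by (metis add_self add_self_left add_0_right)

lemma add_eq_iff: "a + b = c \<longleftrightarrow> a = b + (c::'a)"
  by (metis add_self_left add.commute)

lemma add_power_2: "(a + b) ^ 2 = a ^ 2 + (b::'a) ^ 2"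
  by (simp add: power2_sum two_eq_0)

lemma add_power_2_power: "(a + b) ^ 2 ^ j = a ^ 2 ^ j + (b::'a) ^ 2 ^ j"
  by (induction j) (simp_all add: power_mult add_power_2 mult.commute[of 2])

lemma add_power_4: "(a + b) ^ 4 = a ^ 4 + (b::'a) ^ 4"
  and add_power_16: "(a + b) ^ 16 = a ^ 16 + (b::'a) ^ 16"
  and add_power_64: "(a + b) ^ 64 = a ^ 64 + (b::'a) ^ 64"
  and add_power_256: "(a + b) ^ 256 = a ^ 256 + (b::'a) ^ 256"
  using add_power_2_power[of a b 2] add_power_2_power[of a b 4] add_power_2_power[of a b 6]
    add_power_2_power[of a b 8] by simp_all

lemmas add_powers = add_power_4 add_power_16 add_power_64 add_power_256

lemma power_order_mult: "(x::'a) ^ 2 ^ (m * k) = x"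
  by (induction k) (simp_all add: power_add power_mult power_order)

text \<open>
  Every \<open>z\<close> with \<open>z ^ 255 = 1\<close> is fixed by the \<open>8\<close>-fold Frobenius map, hence, as \<open>m\<close> is prime to
  \<open>8\<close>, by the Frobenius map itself. This covers the exponents \<open>3\<close>, \<open>15\<close>, \<open>17\<close> and \<open>255\<close>.
\<close>
lemma power_inj:
  fixes a b :: 'a
  assumes "d dvd 255" "a ^ d = b ^ d"
  shows "a = b"
proof (cases "b = 0")
  case True
  then show ?thesis using assms by (auto simp: power_0_left split: if_splits)
next
  case False
  define z where "z = a / b"
  obtain e where e: "255 = d * e" using assms(1) by blast
  have "z ^ d = 1" using assms False by (simp add: z_def power_divide)
  then have "z ^ 255 = 1" by (simp add: e power_mult)
  then have *: "z ^ 2 ^ (8 * j) = z" for j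
  proof (induction j)
    case (Suc j)
    have "z ^ 2 ^ (8 * Suc j) = (z ^ 2 ^ (8 * j)) ^ 256"
      by (simp add: power_add mult.commute flip: power_mult)
    also have "\<dots> = z ^ Suc 255" using Suc by simp
    also have "\<dots> = z" using Suc.prems by (simp only: power_Suc mult_1_right)
    finally show ?case .
  qed simp
  \<comment> \<open>An odd square is \<open>1\<close> modulo \<open>8\<close>.\<close>
  obtain i where i: "m = Suc (2 * i)" using odd_degree by (auto elim: oddE)
  have "even (i * Suc i)" by simp
  then obtain j where j: "i * Suc i = 2 * j" by blast
  have "m * m = 4 * (i * Suc i) + 1" by (simp add: i algebra_simps)
  then have mm: "m * m = 8 * j + 1" using j by simp
  have "z = z ^ 2 ^ (m * m)" by (simp only: power_order_mult)
  also have "\<dots> = (z ^ 2 ^ (8 * j)) ^ 2" by (simp only: mm power_add power_mult power_one_right)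
  also have "\<dots> = z * z" by (simp only: * power2_eq_square)
  finally have "z = 1 \<or> z = 0" by auto
  moreover have "z \<noteq> 0" using \<open>z ^ 255 = 1\<close> by auto
  ultimately show ?thesis using False by (simp add: z_def)
qed

lemma power_surj:
  assumes "d dvd 255"
  obtains a :: 'a where "a ^ d = b"
proof -
  have "inj (\<lambda>a::'a. a ^ d)" using power_inj[OF assms] by (auto simp: inj_def)
  then have "surj (\<lambda>a::'a. a ^ d)" by (simp add: finite_UNIV_inj_surj)
  then show ?thesis using that by (metis surjD)
qed

section \<open>The image of the Artin--Schreier map\<close>

text \<open>
  This is the kernel of the trace to the prime field, a subgroup of index two. Its description as an
  image lets the equations \<open>q ^ 16 + q = c\<close> and \<open>q ^ 4 + q = c\<close>, which decide about zeros of the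
  two additive polynomials below, be compared: both maps have this same image.
\<close>
definition artin_schreier :: "'a set" where
  "artin_schreier = range (\<lambda>q. q ^ 2 + q)"

lemma two_to_one_card_range:
  fixes g :: "'a \<Rightarrow> 'a"
  assumes additive: "\<And>a b. g (a + b) = g a + g b"
    and kernel: "\<And>a. g a = 0 \<longleftrightarrow> a = 0 \<or> a = 1"
  shows "2 * card (range g) = CARD('a)"
proof -
  have "{a. g a = g b} = {b, b + 1}" for b
  proof -
    have "g a = g b \<longleftrightarrow> a + b = 0 \<or> a + b = 1" for a
      using kernel[of "a + b"] by (simp add: additive add_eq_0_iff_eq)
    then show ?thesis by (auto simp: add_eq_0_iff_eq add_eq_iff)
  qed
  then have "card {a. g a = y} = 2" if "y \<in> range g" for y
    using that by (auto simp: card_insert_if add_eq_iff)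
  then have "(\<Sum>y\<in>range g. card {a. a \<in> UNIV \<and> g a = y}) = 2 * card (range g)"
    by simp
  moreover have "CARD('a) = (\<Sum>y\<in>range g. card {a. a \<in> UNIV \<and> g a = y})"
    using sum.image_gen[of "UNIV :: 'a set" "\<lambda>_. 1::nat" g] by simp
  ultimately show ?thesis by simp
qed

lemma power_Suc_eq_self_imp:
  fixes a :: 'a
  assumes "d dvd 255" "a ^ Suc d = a"
  shows "a = 0 \<or> a = 1"
  using assms power_inj[of d a 1] by auto

lemma card_artin_schreier: "2 * card artin_schreier = 2 ^ m"
proof -
  have "q ^ 2 + q = 0 \<longleftrightarrow> q = 0 \<or> q = 1" for q :: 'a
    by (simp add: add_eq_0_iff_eq power2_eq_square)
  from two_to_one_card_range[OF _ this] show ?thesis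
    by (simp add: artin_schreier_def card_field add_power_2 add_ac)
qed

text \<open>
  With \<open>P q = q ^ 2 + q\<close> the map \<open>q \<mapsto> q ^ 4 + q\<close> is \<open>P \<circ> P\<close>, so its image lies in that of \<open>P\<close>;
  as \<open>K\<close> has no primitive cube roots of unity, both images have index two. The same argument
  applies to \<open>q \<mapsto> q ^ 16 + q\<close>.
\<close>
lemma range_power_4: "range (\<lambda>q. q ^ 4 + q) = artin_schreier"
proof (rule card_subset_eq)
  have "q ^ 4 + q = 0 \<longleftrightarrow> q = 0 \<or> q = 1" for q :: 'a
    using power_Suc_eq_self_imp[of 3 q] by (auto simp: add_eq_0_iff_eq)
  from two_to_one_card_range[OF _ this]
  have "2 * card (range (\<lambda>q::'a. q ^ 4 + q)) = 2 * card artin_schreier"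
    by (simp add: card_artin_schreier card_field add_power_4 add_ac)
  then show "card (range (\<lambda>q::'a. q ^ 4 + q)) = card artin_schreier" by simp
  have "q ^ 4 + q = (q ^ 2 + q) ^ 2 + (q ^ 2 + q)" for q :: 'a
    by (simp add: add_power_2 add_ac flip: power_mult)
  then show "range (\<lambda>q. q ^ 4 + q) \<subseteq> artin_schreier"
    unfolding artin_schreier_def by (intro image_subsetI range_eqI)
qed simp

lemma range_power_16: "range (\<lambda>q. q ^ 16 + q) = artin_schreier"
proof (rule card_subset_eq)
  have "q ^ 16 + q = 0 \<longleftrightarrow> q = 0 \<or> q = 1" for q :: 'a
    using power_Suc_eq_self_imp[of 15 q] by (auto simp: add_eq_0_iff_eq)
  from two_to_one_card_range[OF _ this]
  have "2 * card (range (\<lambda>q::'a. q ^ 16 + q)) = 2 * card artin_schreier"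
    by (simp add: card_artin_schreier card_field add_power_16 add_ac)
  then show "card (range (\<lambda>q::'a. q ^ 16 + q)) = card artin_schreier" by simp
  have "q ^ 16 + q = (q ^ 4 + q) ^ 4 + (q ^ 4 + q)" for q :: 'a
    by (simp add: add_power_4 add_ac flip: power_mult)
  then show "range (\<lambda>q. q ^ 16 + q) \<subseteq> artin_schreier"
    unfolding range_power_4[symmetric] by (intro image_subsetI range_eqI)
qed simp

section \<open>The two additive polynomials attached to the trinomial\<close>

definition full_kernel :: "'a \<Rightarrow> 'a set" where
  "full_kernel y = {z. z ^ 256 + y * z ^ 16 + z = 0}"

definition factor_kernel :: "'a \<Rightarrow> 'a set" where
  "factor_kernel x = {z. z ^ 16 + x * z ^ 4 + z / x ^ 3 = 0}"

lemma trinomial_eq: "trinomial x = 1 / x ^ 48 + x ^ 20 + (x::'a) ^ 3"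
  by (simp add: trinomial_def power_int_minus divide_inverse)

text \<open>
  This is the factorisation
  \<open>\<sigma>\<^sup>4 + f x \<sigma>\<^sup>2 + 1 = (\<sigma>\<^sup>2 + x\<^bsup>16\<^esup> \<sigma> + x\<^bsup>3\<^esup>) (\<sigma>\<^sup>2 + x \<sigma> + x\<^bsup>-3\<^esup>)\<close>,
  where \<open>\<sigma> c = c\<^bsup>4\<^esup> \<sigma>\<close>: the coefficients of \<open>\<sigma>\<^sup>3\<close> and of \<open>\<sigma>\<close> cancel, and that of \<open>\<sigma>\<^sup>2\<close> is the
  trinomial.
\<close>
lemma in_full_kernel_iff:
  fixes x z :: 'a
  assumes x: "x \<noteq> 0"
  defines "w \<equiv> z ^ 16 + x * z ^ 4 + z / x ^ 3"
  shows "z \<in> full_kernel (trinomial x) \<longleftrightarrow> w ^ 16 + x ^ 16 * w ^ 4 + x ^ 3 * w = 0"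
proof -
  have "w ^ 4 = z ^ 64 + x ^ 4 * z ^ 16 + z ^ 4 / x ^ 12"
    by (simp add: w_def add_powers power_mult_distrib power_divide flip: power_mult)
  moreover have "w ^ 16 = z ^ 256 + x ^ 16 * z ^ 64 + z ^ 16 / x ^ 48"
    by (simp add: w_def add_powers power_mult_distrib power_divide flip: power_mult)
  moreover have "x ^ 16 * (z ^ 64 + x ^ 4 * z ^ 16 + z ^ 4 / x ^ 12)
      = x ^ 16 * z ^ 64 + x ^ 20 * z ^ 16 + x ^ 4 * z ^ 4"
  proof -
    have "x ^ 16 * (z ^ 4 / x ^ 12) = x ^ 4 * z ^ 4"
      using x by (simp add: power_eq_if)
    moreover have "x ^ 16 * (x ^ 4 * z ^ 16) = x ^ 20 * z ^ 16"
      using power_add[of x 16 4] by simp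
    ultimately show ?thesis by (simp only: distrib_left)
  qed
  moreover have "x ^ 3 * w = x ^ 3 * z ^ 16 + x ^ 4 * z ^ 4 + z"
  proof -
    have "x ^ 3 * (x * z ^ 4) = x ^ 4 * z ^ 4"
      using power_add[of x 3 1] by simp
    moreover have "x ^ 3 * (z / x ^ 3) = z"
      using x by simp
    ultimately show ?thesis by (simp only: w_def distrib_left)
  qed
  ultimately have "w ^ 16 + x ^ 16 * w ^ 4 + x ^ 3 * w
      = (z ^ 256 + x ^ 16 * z ^ 64 + z ^ 16 / x ^ 48)
        + (x ^ 16 * z ^ 64 + x ^ 20 * z ^ 16 + x ^ 4 * z ^ 4)
        + (x ^ 3 * z ^ 16 + x ^ 4 * z ^ 4 + z)"
    by (simp only:)
  also have "\<dots> = z ^ 256 + (z ^ 16 / x ^ 48 + x ^ 20 * z ^ 16 + x ^ 3 * z ^ 16) + z"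
    by (simp only: add_ac add_self_left add_self add_0_right add_0_left)
  also have "\<dots> = z ^ 256 + trinomial x * z ^ 16 + z"
    by (simp add: trinomial_eq distrib_right)
  finally show ?thesis by (simp add: full_kernel_def)
qed

lemma factor_kernel_subset_full_kernel:
  assumes "x \<noteq> 0"
  shows "factor_kernel x \<subseteq> full_kernel (trinomial x)"
proof
  fix z assume "z \<in> factor_kernel x"
  then have "z ^ 16 + x * z ^ 4 + z / x ^ 3 = 0"
    by (simp only: factor_kernel_def mem_Collect_eq)
  then show "z \<in> full_kernel (trinomial x)"
    by (simp only: in_full_kernel_iff[OF assms]) simp
qed

text \<open>
  On the fixed vectors of \<open>\<Phi> = \<Psi>\<^sup>2\<close> the map \<open>\<Psi>\<close> is an additive involution, so for such a vector
  \<open>z\<close> either \<open>z\<close> itself or \<open>z + \<Psi> z\<close> is a nonzero fixed vector of \<open>\<Psi>\<close>. With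
  \<open>z\<close> standing for the vector \<open>(z ^ 16, z)\<close>, the second coordinate of \<open>z + \<Psi> z\<close> is the element
  \<open>t\<close> of the proof.
\<close>
lemma factor_kernel_nontrivial:
  assumes x: "x \<noteq> 0" and z: "z \<in> full_kernel (trinomial x)" "z \<noteq> 0"
  obtains t where "t \<in> factor_kernel x" "t \<noteq> 0"
proof (cases "z \<in> factor_kernel x")
  case True
  then show ?thesis using that z by blast
next
  case False
  define w where "w = z ^ 16 + x * z ^ 4 + z / x ^ 3"
  have w: "w \<noteq> 0" using False by (simp add: w_def factor_kernel_def)
  have rel: "w ^ 16 + x ^ 16 * w ^ 4 = x ^ 3 * w"
    using in_full_kernel_iff[OF x, of z] z by (simp add: w_def add_eq_0_iff_eq)
  define t where "t = w ^ 4 / x + x ^ 3 * w"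
  have "t ^ 4 = (w ^ 16 + x ^ 16 * w ^ 4) / x ^ 4"
    using x by (simp add: t_def add_powers power_mult_distrib field_simps flip: power_mult)
  also have "\<dots> = w / x"
    unfolding rel using x by (simp add: eval_nat_numeral)
  finally have wt: "w = x * t ^ 4"
    using x by simp
  have "t = w ^ 4 / x + x ^ 3 * w"
    by (rule t_def)
  also have "w ^ 4 / x = x ^ 3 * t ^ 16"
    unfolding wt power_mult_distrib using x by (simp add: eval_nat_numeral)
  also have "x ^ 3 * w = x ^ 4 * t ^ 4"
    unfolding wt by (simp add: eval_nat_numeral)
  finally have "t = x ^ 3 * t ^ 16 + x ^ 4 * t ^ 4" .
  then have "t / x ^ 3 = (x ^ 3 * t ^ 16 + x ^ 4 * t ^ 4) / x ^ 3"
    by (rule arg_cong)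
  also have "\<dots> = t ^ 16 + x * t ^ 4"
    using x by (simp add: add_divide_distrib eval_nat_numeral)
  finally have "t / x ^ 3 = t ^ 16 + x * t ^ 4" .
  then have "t \<in> factor_kernel x"
    by (simp add: factor_kernel_def)
  moreover have "t \<noteq> 0" using wt w by auto
  ultimately show ?thesis using that by blast
qed

section \<open>Zeros of the full polynomial\<close>

lemma in_full_kernel_iff_eq:
  fixes u y :: 'a
  assumes "u \<noteq> 0"
  shows "u \<in> full_kernel y \<longleftrightarrow> y = (u ^ 256 + u) / u ^ 16"
proof -
  have "u \<in> full_kernel y \<longleftrightarrow> y * u ^ 16 + (u ^ 256 + u) = 0"
    by (simp add: full_kernel_def add_ac)
  then show ?thesis
    using assms by (simp add: nonzero_eq_divide_eq add_eq_0_iff_eq)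
qed

lemma zero_in_full_kernel [simp]: "0 \<in> full_kernel y"
  by (simp add: full_kernel_def)

text \<open>
  The Moore determinant of \<open>u\<close>, \<open>v\<close> for \<open>z \<mapsto> z ^ 16\<close>, the analogue of a Wronskian. On the
  zeros of \<open>z ^ 256 + y * z ^ 16 + z\<close> it satisfies \<open>c ^ 16 = c\<close>, because the coefficient of \<open>z\<close>
  is \<open>1\<close>, and so takes values in the prime field.
\<close>
definition moore16 :: "'a \<Rightarrow> 'a \<Rightarrow> 'a" where
  "moore16 u v = u * v ^ 16 + u ^ 16 * v"

lemma moore16_add: "moore16 u (v + w) = moore16 u v + moore16 u w"
  by (simp add: moore16_def add_powers algebra_simps)

lemma moore16_eq_0_iff:
  assumes "u \<noteq> 0"
  shows "moore16 u v = 0 \<longleftrightarrow> v = 0 \<or> v = u"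
proof -
  have "v = u" if "v ^ 15 = u ^ 15" using power_inj[of 15] that by auto
  moreover have "moore16 u v = u * v * (v ^ 15 + u ^ 15)"
    by (simp add: moore16_def algebra_simps flip: power_Suc power_Suc2)
  ultimately show ?thesis using assms by (auto simp: add_eq_0_iff_eq)
qed

lemma in_full_kernel_iff_moore16:
  fixes u y :: 'a
  assumes u: "u \<noteq> 0" "u \<in> full_kernel y"
  shows "v \<in> full_kernel y \<longleftrightarrow> v = 0 \<or> v = u \<or> moore16 u v = 1"
proof -
  have y: "y * u ^ 16 = u ^ 256 + u"
    using u by (simp add: in_full_kernel_iff_eq)
  define c where "c = moore16 u v"
  have "c ^ 16 + c = u ^ 16 * v ^ 256 + u ^ 256 * v ^ 16 + u * v ^ 16 + u ^ 16 * v"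
    by (simp add: c_def moore16_def add_powers power_mult_distrib add_ac flip: power_mult)
  also have "\<dots> = u ^ 16 * v ^ 256 + (u ^ 256 + u) * v ^ 16 + u ^ 16 * v"
    by (simp add: algebra_simps)
  also have "\<dots> = u ^ 16 * (v ^ 256 + y * v ^ 16 + v)"
    unfolding y[symmetric] by (simp add: algebra_simps)
  finally have "v \<in> full_kernel y \<longleftrightarrow> c ^ 16 + c = 0"
    using u by (simp add: full_kernel_def)
  also have "\<dots> \<longleftrightarrow> c = 0 \<or> c = 1"
    using power_Suc_eq_self_imp[of 15 c] by (auto simp: add_eq_0_iff_eq)
  finally show ?thesis using moore16_eq_0_iff[OF u(1)] by (auto simp: c_def)
qed

text \<open>
  Writing \<open>v = u * q\<close> turns \<open>moore16 u v = 1\<close> into the equation \<open>q ^ 16 + q = 1 / u ^ 17\<close>.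
\<close>
lemma ex_moore16_eq_1_iff:
  assumes u: "u \<noteq> 0"
  shows "(\<exists>v. moore16 u v = 1) \<longleftrightarrow> 1 / u ^ 17 \<in> artin_schreier"
proof -
  have *: "moore16 u (u * q) = 1 \<longleftrightarrow> 1 / u ^ 17 = q ^ 16 + q" for q
  proof -
    have "moore16 u (u * q) = u ^ 17 * (q ^ 16 + q)"
      by (simp add: moore16_def power_mult_distrib eval_nat_numeral algebra_simps)
    then show ?thesis using u by (auto simp: field_simps)
  qed
  have "(\<exists>v. moore16 u v = 1) \<longleftrightarrow> (\<exists>q. moore16 u (u * q) = 1)"
    using u by (metis mult.commute nonzero_divide_eq_eq)
  then show ?thesis by (auto simp: * simp flip: range_power_16)
qed

lemma full_kernel_eq_moore16_1:
  assumes u: "u \<noteq> 0" "u \<in> full_kernel y" and v: "moore16 u v = 1"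
  shows "full_kernel y = {0, u, v, u + v}" "card (full_kernel y) = 4"
proof -
  have "moore16 u w = 1 \<longleftrightarrow> w = v \<or> w = u + v" for w
  proof -
    have "moore16 u w = 1 \<longleftrightarrow> moore16 u (w + v) = 0"
      by (simp add: moore16_add v add_eq_0_iff_eq)
    also have "\<dots> \<longleftrightarrow> w = v \<or> w = u + v"
      by (auto simp: moore16_eq_0_iff[OF u(1)] add_eq_0_iff_eq add_eq_iff add.commute)
    finally show ?thesis .
  qed
  then show eq: "full_kernel y = {0, u, v, u + v}"
    using in_full_kernel_iff_moore16[OF u] by auto
  have "v \<noteq> 0" "v \<noteq> u"
    using v moore16_eq_0_iff[OF u(1), of v] by auto
  then show "card (full_kernel y) = 4"
    using u(1) by (simp add: eq card_insert_if add_eq_0_iff_eq add_eq_iff eq_commute[of _ "u + v"])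
qed

lemma card_full_kernel:
  assumes u: "u \<noteq> 0" "u \<in> full_kernel y"
  shows "card (full_kernel y) = (if 1 / u ^ 17 \<in> artin_schreier then 4 else 2)"
proof (cases "1 / u ^ 17 \<in> artin_schreier")
  case True
  then show ?thesis
    using ex_moore16_eq_1_iff[OF u(1)] full_kernel_eq_moore16_1(2)[OF u] by auto
next
  case False
  then have "full_kernel y = {0, u}"
    using ex_moore16_eq_1_iff[OF u(1)] in_full_kernel_iff_moore16[OF u] by auto
  then show ?thesis using False u by simp
qed

lemma card_full_kernel_cases:
  obtains "full_kernel y = {0}" | "card (full_kernel y) = 2" | "card (full_kernel y) = 4"
proof (cases "full_kernel y = {0}")
  case False
  then obtain u where "u \<noteq> 0" "u \<in> full_kernel y"
    using zero_in_full_kernel[of y] by blast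
  from card_full_kernel[OF this] show ?thesis using that by (auto split: if_splits)
qed (rule that)

text \<open>
  A two-element kernel \<open>{0, u}\<close> corresponds to a single \<open>u\<close> with \<open>1 / u ^ 17\<close> outside a subgroup of
  index two, and \<open>u \<mapsto> 1 / u ^ 17\<close> permutes \<open>K\<close> (with \<open>0\<close> sent to \<open>0\<close>, which lies in the subgroup).
\<close>
lemma card_full_kernel_eq_2: "card {y. card (full_kernel y) = 2} = 2 ^ (m - 1)"
proof -
  define S where "S = {u::'a. 1 / u ^ 17 \<notin> artin_schreier}"
  have "0 \<in> artin_schreier" by (auto simp: artin_schreier_def intro: range_eqI[of _ _ 0])
  then have nz: "u \<noteq> 0" if "u \<in> S" for u using that by (auto simp: S_def)
  have "bij (\<lambda>u::'a. 1 / u ^ 17)"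
  proof -
    have "inj (\<lambda>u::'a. 1 / u ^ 17)"
      using power_inj[of 17] by (auto simp: inj_def)
    then show ?thesis by (simp add: bij_def finite_UNIV_inj_surj)
  qed
  then have "bij_betw (\<lambda>u. 1 / u ^ 17) S (- artin_schreier)"
    unfolding S_def by (rule bij_betw_subset) (use \<open>bij _\<close> in \<open>auto simp: bij_def image_iff surj_def\<close>)
  then have "card S = card (- artin_schreier)" by (rule bij_betw_same_card)
  also have "\<dots> = 2 ^ m - card artin_schreier"
    by (simp add: Compl_eq_Diff_UNIV card_Diff_subset card_field)
  finally have "2 * card S = 2 ^ m" using card_artin_schreier by simp
  moreover have "bij_betw (\<lambda>u. (u ^ 256 + u) / u ^ 16) S {y. card (full_kernel y) = 2}"
  proof (rule bij_betw_imageI)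
    have two: "u \<in> full_kernel ((u ^ 256 + u) / u ^ 16)" "card (full_kernel ((u ^ 256 + u) / u ^ 16)) = 2" if "u \<in> S" for u
      using card_full_kernel[of u] in_full_kernel_iff_eq[of u] nz[OF that] that by (auto simp: S_def)
    show "inj_on (\<lambda>u. (u ^ 256 + u) / u ^ 16) S"
    proof (rule inj_onI)
      fix u v assume uv: "u \<in> S" "v \<in> S" "(u ^ 256 + u) / u ^ 16 = (v ^ 256 + v) / v ^ 16"
      show "u = v"
        using two[OF uv(1)] two[OF uv(2)] uv nz
        by (metis (no_types, lifting) card_2_iff' zero_in_full_kernel)
    qed
    have "\<exists>u\<in>S. y = (u ^ 256 + u) / u ^ 16" if y: "card (full_kernel y) = 2" for y
    proof -
      obtain u where "u \<noteq> 0" "u \<in> full_kernel y" using y by (metis card_2_iff')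
      then show ?thesis using card_full_kernel[of u y] y in_full_kernel_iff_eq[of u y]
        by (auto simp: S_def split: if_splits)
    qed
    then show "(\<lambda>u. (u ^ 256 + u) / u ^ 16) ` S = {y. card (full_kernel y) = 2}"
      using two by auto
  qed
  ultimately have "2 * card {y. card (full_kernel y) = 2} = 2 ^ m"
    by (simp add: bij_betw_same_card)
  moreover have "(2::nat) ^ m = 2 * 2 ^ (m - 1)"
    using odd_pos[OF odd_degree] by (simp flip: power_Suc)
  ultimately show ?thesis by simp
qed

text \<open>
  Every \<open>y\<close> has the zero \<open>0\<close>, and every nonzero \<open>u\<close> is a zero for exactly one \<open>y\<close>.
\<close>
lemma sum_card_full_kernel: "(\<Sum>y\<in>UNIV. card (full_kernel y)) + 1 = 2 * 2 ^ m"
proof -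
  have "(\<Sum>y\<in>UNIV. card {u. u \<in> - {0::'a} \<and> (u ^ 256 + u) / u ^ 16 = y}) = card (- {0::'a})"
    using sum.group[of "- {0::'a}" UNIV "\<lambda>u. (u ^ 256 + u) / u ^ 16" "\<lambda>_. 1::nat"] by simp
  also have "\<dots> = 2 ^ m - 1" by (simp add: Compl_eq_Diff_UNIV card_Diff_subset card_field)
  finally have "(\<Sum>y\<in>UNIV. card {u. u \<in> - {0::'a} \<and> (u ^ 256 + u) / u ^ 16 = y}) + 1 = 2 ^ m"
    by simp
  moreover have "card (full_kernel y) = 1 + card {u. u \<in> - {0::'a} \<and> (u ^ 256 + u) / u ^ 16 = y}" for y
  proof -
    have "full_kernel y = insert 0 {u. u \<in> - {0} \<and> (u ^ 256 + u) / u ^ 16 = y}"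
      using in_full_kernel_iff_eq[of _ y] by auto
    then show ?thesis by simp
  qed
  ultimately show ?thesis
    by (simp only: sum.distrib) (simp add: card_field)
qed

section \<open>Preimages when the kernel is nontrivial\<close>

lemma factor_kernel_iff:
  fixes x z :: 'a
  assumes "x \<noteq> 0" "z \<noteq> 0"
  shows "z \<in> factor_kernel x \<longleftrightarrow> (1 / x) ^ 4 + z ^ 15 * (1 / x) = z ^ 3"
proof -
  have "(z ^ 16 + x * z ^ 4 + z / x ^ 3) * (1 / (x * z)) = (1 / x) ^ 4 + z ^ 15 * (1 / x) + z ^ 3"
    using assms by (simp add: field_simps eval_nat_numeral)
  then have "z \<in> factor_kernel x \<longleftrightarrow> (1 / x) ^ 4 + z ^ 15 * (1 / x) + z ^ 3 = 0"
    using assms by (auto simp: factor_kernel_def)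
  then show ?thesis by (simp only: add_eq_0_iff_eq)
qed

text \<open>
  A nonzero zero \<open>t\<close> of the factor gives \<open>\<gamma> = 1 / (x * t ^ 5)\<close> with \<open>\<gamma> ^ 4 + \<gamma> = 1 / t ^ 17\<close>, while a
  second nonzero element of the full kernel requires \<open>q\<close> with \<open>q ^ 16 + q = 1 / t ^ 17\<close>; the two
  equations are solvable simultaneously.
\<close>
lemma card_full_kernel_trinomial_neq_2:
  assumes "x \<noteq> 0"
  shows "card (full_kernel (trinomial x)) \<noteq> 2"
proof
  assume two: "card (full_kernel (trinomial x)) = 2"
  then obtain z where "z \<in> full_kernel (trinomial x)" "z \<noteq> 0" by (metis card_2_iff')
  then obtain t where t: "t \<in> factor_kernel x" "t \<noteq> 0"
    using factor_kernel_nontrivial assms by blast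
  define \<gamma> where "\<gamma> = 1 / (x * t ^ 5)"
  have "t ^ 20 * (\<gamma> ^ 4 + \<gamma>) = (1 / x) ^ 4 + t ^ 15 * (1 / x)"
    using t(2) assms by (simp add: \<gamma>_def field_simps)
  also have "\<dots> = t ^ 3" using factor_kernel_iff[OF assms t(2)] t(1) by simp
  finally have "t ^ 3 * (t ^ 17 * (\<gamma> ^ 4 + \<gamma>)) = t ^ 3 * 1"
    by (simp flip: mult.assoc power_add)
  then have "1 / t ^ 17 = \<gamma> ^ 4 + \<gamma>"
    using t(2) by (simp add: nonzero_divide_eq_eq mult.commute)
  then have "1 / t ^ 17 \<in> artin_schreier"
    by (auto simp flip: range_power_4)
  then show False
    using card_full_kernel[OF t(2)] t(1) factor_kernel_subset_full_kernel[OF assms] two by auto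
qed

text \<open>
  The Moore determinant for \<open>z \<mapsto> z ^ 4\<close>. If \<open>u\<close>, \<open>v\<close> is a basis of a four-element kernel, then
  \<open>x = 1 / moore4 u v\<close> is the solution whose factor vanishes on the whole kernel.
\<close>
definition moore4 :: "'a \<Rightarrow> 'a \<Rightarrow> 'a" where
  "moore4 u v = u * v ^ 4 + u ^ 4 * v"

text \<open>
  By \<open>factor_kernel_iff\<close>, \<open>1 / x\<close> is a root of the affine polynomial
  \<open>b ^ 4 + u ^ 15 * b + u ^ 3\<close>. One root is \<open>moore4 u v\<close>, and two roots differ by a root of
  \<open>d ^ 4 + u ^ 15 * d\<close>, that is, by \<open>0\<close> or \<open>u ^ 5\<close>.
\<close>
lemma factor_kernel_member:
  assumes "x \<noteq> 0" "u \<noteq> 0" "u \<in> factor_kernel x" "moore16 u v = 1"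
  shows "1 / x = moore4 u v \<or> 1 / x = moore4 u v + u ^ 5"
proof -
  define e where "e = moore4 u v"
  define d where "d = 1 / x + e"
  have "e ^ 4 = u ^ 4 * v ^ 16 + u ^ 16 * v ^ 4"
    by (simp add: e_def moore4_def add_power_4 power_mult_distrib flip: power_mult)
  moreover have "u ^ 15 * e = u ^ 16 * v ^ 4 + u ^ 19 * v"
    by (simp add: e_def moore4_def distrib_left eval_nat_numeral mult_ac)
  moreover have "u ^ 3 * moore16 u v = u ^ 4 * v ^ 16 + u ^ 19 * v"
    by (simp add: moore16_def distrib_left eval_nat_numeral mult_ac)
  ultimately have "e ^ 4 + u ^ 15 * e = u ^ 3"
    by (simp add: assms add_ac)
  moreover have "(1 / x) ^ 4 + u ^ 15 * (1 / x) = u ^ 3"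
    using factor_kernel_iff assms by blast
  moreover have "d ^ 4 + u ^ 15 * d = ((1 / x) ^ 4 + u ^ 15 * (1 / x)) + (e ^ 4 + u ^ 15 * e)"
    unfolding d_def add_power_4 by (simp add: algebra_simps)
  ultimately have "d * (d ^ 3 + u ^ 15) = 0"
    by (simp add: algebra_simps flip: power_Suc power_Suc2)
  moreover have "d = u ^ 5" if "d ^ 3 = u ^ 15"
    using power_inj[of 3 d "u ^ 5"] that by (simp flip: power_mult)
  ultimately have "d = 0 \<or> d = u ^ 5" by (auto simp: add_eq_0_iff_eq)
  moreover have "1 / x = e + d" by (simp add: d_def add.left_commute two_eq_0)
  ultimately show ?thesis by (auto simp: e_def)
qed

text \<open>
  The factor of \<open>x\<close> has a nonzero zero in \<open>{u, v, u + v}\<close>. Since \<open>moore4\<close> has the same value \<open>e\<close>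
  for every basis of the kernel, this leaves for \<open>1 / x\<close> only \<open>e\<close> and the three elements
  \<open>e + t ^ 5\<close>.
\<close>
lemma card_preimage_le_4:
  assumes "card (full_kernel y) = 4"
  shows "card {x. x \<noteq> 0 \<and> trinomial x = y} \<le> 4"
proof -
  have "\<not> full_kernel y \<subseteq> {0}" using assms card_mono[of "{0}" "full_kernel y"] by auto
  then obtain u where u: "u \<noteq> 0" "u \<in> full_kernel y" by blast
  have "1 / u ^ 17 \<in> artin_schreier"
    using card_full_kernel[OF u] assms by (simp split: if_splits)
  then obtain v where uv: "moore16 u v = 1" using ex_moore16_eq_1_iff[OF u(1)] by blast
  note V = full_kernel_eq_moore16_1(1)[OF u uv]
  define e where "e = moore4 u v"
  have basis: "moore16 v u = 1" "moore16 (u + v) v = 1"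
     "moore4 v u = e" "moore4 (u + v) v = e"
    using uv by (simp_all add: e_def moore16_def moore4_def add_powers algebra_simps
      flip: power_Suc power_Suc2)
  have "inverse x \<in> {e, e + u ^ 5, e + v ^ 5, e + (u + v) ^ 5}" if x: "x \<noteq> 0" "trinomial x = y" for x
  proof -
    obtain t where t: "t \<in> factor_kernel x" "t \<noteq> 0"
      using factor_kernel_nontrivial[OF x(1)] u x(2) by blast
    then have "t \<in> {u, v, u + v}"
      using factor_kernel_subset_full_kernel[OF x(1)] x(2) V by auto
    then show ?thesis
      using factor_kernel_member[OF x(1) t(2,1), of v] factor_kernel_member[OF x(1) t(2,1), of u]
        uv basis by (auto simp: e_def inverse_eq_divide)
  qed
  then have "inverse ` {x. x \<noteq> 0 \<and> trinomial x = y} \<subseteq> {e, e + u ^ 5, e + v ^ 5, e + (u + v) ^ 5}"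
    by auto
  then have "card (inverse ` {x. x \<noteq> 0 \<and> trinomial x = y}) \<le> card {e, e + u ^ 5, e + v ^ 5, e + (u + v) ^ 5}"
    by (intro card_mono) auto
  also have "\<dots> \<le> 4" by (simp add: card_insert_if)
  finally show ?thesis by (simp add: card_image inj_on_def)
qed

section \<open>Semilinear square roots and the trivial kernel\<close>

definition scale :: "'a \<Rightarrow> 'a \<times> 'a \<Rightarrow> 'a \<times> 'a" where
  "scale c v = (c * fst v, c * snd v)"

lemma scale_scale: "scale c (scale d v) = scale (c * d) v"
  and scale_eq_0_iff: "scale c v = 0 \<longleftrightarrow> c = 0 \<or> v = 0"
  by (auto simp: scale_def prod_eq_iff mult_ac)

lemma pair_add_eq_0_iff: "v + w = 0 \<longleftrightarrow> v = (w :: 'a \<times> 'a)"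
  by (simp add: prod_eq_iff add_eq_0_iff_eq)

lemma independent_pairs_span:
  fixes w w' :: "'a \<times> 'a"
  assumes "w \<noteq> 0" "\<And>s. w' \<noteq> scale s w"
  obtains \<alpha> \<beta> where "v = scale \<alpha> w + scale \<beta> w'"
proof -
  obtain a b c d p q where [simp]: "w = (a, b)" "w' = (c, d)" "v = (p, q)"
    by (metis surj_pair)
  define D where "D = a * d + b * c"
  have "D \<noteq> 0"
  proof
    assume D: "D = 0"
    show False
    proof (cases "a = 0")
      case True
      then have "b \<noteq> 0" "c = 0" using assms(1) D by (auto simp: D_def zero_prod_def)
      then show False using assms(2)[of "d / b"] True by (simp add: scale_def)
    next
      case False
      then have "d = c / a * b" using D by (simp add: D_def add_eq_0_iff_eq field_simps)
      then show False using assms(2)[of "c / a"] False by (simp add: scale_def)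
    qed
  qed
  moreover have "(p * d + q * c) * a + (a * q + b * p) * c = p * D"
    and "(p * d + q * c) * b + (a * q + b * p) * d = q * D"
    by (simp_all add: D_def algebra_simps two_eq_0)
  ultimately have "p = (p * d + q * c) / D * a + (a * q + b * p) / D * c"
    and "q = (p * d + q * c) / D * b + (a * q + b * p) / D * d"
    by (simp_all add: nonzero_eq_divide_eq flip: add_divide_distrib)
  then show ?thesis using that[of "(p * d + q * c) / D" "(a * q + b * p) / D"]
    by (simp add: scale_def)
qed

text \<open>
  The Galois group of \<open>K\<close> has odd order \<open>m\<close>.
\<close>
lemma frobenius_not_of_order_2:
  assumes "\<And>c::'a. (c ^ 4 ^ j) ^ 4 ^ j = c"
  shows "(c::'a) ^ 4 ^ j = c"
proof -
  have four: "(4::nat) ^ k = 2 ^ (2 * k)" for k by (simp add: power_mult)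
  have period: "(c::'a) ^ 4 ^ (2 * j * k) = c" for k
  proof (induction k)
    case (Suc k)
    have "(4::nat) ^ (2 * j * Suc k) = 4 ^ (2 * j * k) * 4 ^ j * 4 ^ j"
      by (simp add: power_add mult_2)
    then show ?case using assms Suc by (simp only: power_mult)
  qed simp
  obtain i where i: "m = Suc (2 * i)" using odd_degree by (auto elim: oddE)
  have "c = c ^ 4 ^ (2 * j * Suc i)" by (simp only: period)
  also have "(4::nat) ^ (2 * j * Suc i) = 2 ^ (m * (2 * j)) * 4 ^ j"
    by (simp only: four flip: power_add) (simp add: i algebra_simps)
  also have "c ^ \<dots> = c ^ 4 ^ j"
    by (simp only: power_mult[of c] power_order_mult)
  finally show ?thesis ..
qed

text \<open>
  If \<open>F\<close> had even order \<open>2 * j\<close>, then \<open>P = F ^^ j\<close> would be an involution. It is semilinear for an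
  automorphism whose square is trivial, hence linear. In characteristic two an involution has a
  nonzero fixed vector \<open>w = v + P v\<close>. As \<open>P \<noteq> id\<close>, the fixed space of \<open>P\<close> is the line of \<open>w\<close>, and
  \<open>F\<close> preserves it since \<open>F\<close> commutes with \<open>P\<close>. As every element of \<open>K\<close> is a cube, \<open>w\<close> can
  then be rescaled to a fixed vector of \<open>F\<close>.
\<close>
lemma odd_order_of_no_fixed_vector:
  fixes F :: "'a \<times> 'a \<Rightarrow> 'a \<times> 'a"
  assumes additive: "\<And>v w. F (v + w) = F v + F w"
    and semilinear: "\<And>c v. F (scale c v) = scale (c ^ 4) (F v)"
    and kernel: "\<And>v. F v = 0 \<Longrightarrow> v = 0"
    and fixed: "\<And>v. F v = v \<Longrightarrow> v = 0"
  obtains n where "odd n" "F ^^ n = id"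
proof -
  have "inj F"
  proof (rule injI)
    fix v w assume "F v = F w"
    then have "F (v + w) = 0" by (simp add: additive pair_add_eq_0_iff)
    then show "v = w" using kernel pair_add_eq_0_iff by blast
  qed
  then have "permutation F"
    by (simp add: permutation finite_UNIV_inj_surj bij_def)
  then have ex: "\<exists>N. F ^^ N = id \<and> N > 0"
    using permutation_is_nilpotent by metis
  define N where "N = (LEAST N. F ^^ N = id \<and> N > 0)"
  have N: "F ^^ N = id" "N > 0"
    using LeastI_ex[OF ex] by (auto simp: N_def)
  have "odd N"
  proof
    assume "even N"
    then obtain j where j: "N = j + j" by (metis evenE mult_2)
    define P where "P = F ^^ j"
    have "P \<noteq> id"
      using not_less_Least[of j "\<lambda>N. F ^^ N = id \<and> N > 0"] N j
      by (simp add: N_def [symmetric] P_def)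
    have PP: "P (P v) = v" for v
      using fun_cong[OF N(1), of v] by (simp add: j P_def funpow_add)
    have P_add: "P (v + w) = P v + P w" for v w
      unfolding P_def by (induction j) (simp_all add: additive)
    have P_semi: "P (scale c v) = scale (c ^ 4 ^ j) (P v)" for c v
      unfolding P_def by (induction j) (simp_all add: semilinear mult.commute flip: power_mult)
    have "(c ^ 4 ^ j) ^ 4 ^ j = c" for c :: 'a
      using PP[of "scale c (1, 0)"] by (simp only: P_semi PP) (simp add: scale_def)
    then have "c ^ 4 ^ j = c" for c :: 'a
      by (rule frobenius_not_of_order_2)
    then have P_scale: "P (scale c v) = scale c (P v)" for c v
      by (simp only: P_semi)
    have P_F: "P (F v) = F (P v)" for v
      by (simp add: P_def funpow_swap1)
    obtain v where v: "P v \<noteq> v" using \<open>P \<noteq> id\<close> by (auto simp: fun_eq_iff)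
    define w where "w = v + P v"
    have "w \<noteq> 0" using v by (auto simp: w_def pair_add_eq_0_iff)
    have "P w = w" by (simp add: w_def P_add PP add.commute)
    show False
    proof (cases "\<exists>s. F w = scale s w")
      case True
      then obtain s where s: "F w = scale s w" by blast
      have "s \<noteq> 0" using kernel[of w] \<open>w \<noteq> 0\<close> s by (auto simp: scale_eq_0_iff)
      obtain c :: 'a where c: "c ^ 3 = 1 / s" using power_surj[of 3] by auto
      then have "c \<noteq> 0" using \<open>s \<noteq> 0\<close> by auto
      have "c ^ 4 * s = c"
        using c \<open>s \<noteq> 0\<close> by (simp add: eval_nat_numeral field_simps)
      then have "F (scale c w) = scale c w"
        by (simp add: semilinear s scale_scale)
      then show False
        using fixed[of "scale c w"] \<open>c \<noteq> 0\<close> \<open>w \<noteq> 0\<close> by (simp add: scale_eq_0_iff)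
    next
      case False
      then obtain \<alpha> \<beta> where "v = scale \<alpha> w + scale \<beta> (F w)"
        using independent_pairs_span[OF \<open>w \<noteq> 0\<close>, of "F w" v] by blast
      then show False using v by (simp add: P_add P_scale P_F \<open>P w = w\<close>)
    qed
  qed
  then show ?thesis using that N by blast
qed

text \<open>
  The \<open>\<sigma>\<^sup>2\<close>-semilinear map with \<open>\<Phi> e = e'\<close> and \<open>\<Phi> e' = e + y e'\<close> on the standard basis; its
  fixed vectors are the pairs \<open>(z ^ 16, z)\<close> with \<open>z\<close> in \<open>full_kernel y\<close>.
\<close>
definition \<Phi> :: "'a \<Rightarrow> 'a \<times> 'a \<Rightarrow> 'a \<times> 'a" where
  "\<Phi> y v = (snd v ^ 16, fst v ^ 16 + y * snd v ^ 16)"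

text \<open>
  The \<open>\<sigma>\<close>-semilinear map with \<open>\<Psi> (\<Psi> e) = x (\<Psi> e) + x\<^bsup>-3\<^esup> e\<close>, written in the basis \<open>e\<close>,
  \<open>e' = \<Psi> (\<Psi> e)\<close> instead of \<open>e\<close>, \<open>\<Psi> e\<close>, so that for solutions \<open>x\<close> of the same equation
  \<open>f x = y\<close> the squares coincide as functions.
\<close>
definition \<Psi> :: "'a \<Rightarrow> 'a \<times> 'a \<Rightarrow> 'a \<times> 'a" where
  "\<Psi> x v = (fst v ^ 4 / x ^ 4 + snd v ^ 4 / x ^ 16,
            fst v ^ 4 / x + (x ^ 4 + 1 / x ^ 13) * snd v ^ 4)"

lemma \<Psi>_square:
  assumes "x \<noteq> 0"
  shows "\<Psi> x (\<Psi> x v) = \<Phi> (trinomial x) v"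
proof -
  obtain a b where v: "v = (a, b)" by fastforce
  have "(a ^ 4 / x ^ 4 + b ^ 4 / x ^ 16) ^ 4 = a ^ 16 / x ^ 16 + b ^ 16 / x ^ 64"
    by (simp add: add_power_4 power_divide flip: power_mult)
  moreover have "(a ^ 4 / x + (x ^ 4 + 1 / x ^ 13) * b ^ 4) ^ 4
      = a ^ 16 / x ^ 4 + (x ^ 16 + 1 / x ^ 52) * b ^ 16"
    by (simp add: add_power_4 power_divide power_mult_distrib flip: power_mult)
  moreover have "(a ^ 16 / x ^ 16 + b ^ 16 / x ^ 64) / x ^ 4 +
     (a ^ 16 / x ^ 4 + (x ^ 16 + 1 / x ^ 52) * b ^ 16) / x ^ 16 = b ^ 16"
    using assms by (simp add: add_divide_distrib distrib_right add_ac two_eq_0 flip: power_add)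
  moreover have "(a ^ 16 / x ^ 16 + b ^ 16 / x ^ 64) / x +
     (x ^ 4 + 1 / x ^ 13) * (a ^ 16 / x ^ 4 + (x ^ 16 + 1 / x ^ 52) * b ^ 16)
     = a ^ 16 + trinomial x * b ^ 16"
  proof -
    have "(a ^ 16 / x ^ 16 + b ^ 16 / x ^ 64) / x = a ^ 16 / x ^ 17 + b ^ 16 / x ^ 65"
      by (simp add: add_divide_distrib flip: power_Suc2)
    moreover have "(x ^ 4 + 1 / x ^ 13) * (a ^ 16 / x ^ 4) = a ^ 16 + a ^ 16 / x ^ 17"
      using assms by (simp add: distrib_right add_divide_distrib flip: power_add)
    moreover have "(x ^ 4 + 1 / x ^ 13) * ((x ^ 16 + 1 / x ^ 52) * b ^ 16)
        = trinomial x * b ^ 16 + b ^ 16 / x ^ 65"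
    proof -
      have "x ^ 4 / x ^ 52 = 1 / x ^ 48" "x ^ 16 / x ^ 13 = x ^ 3"
        using assms by (simp_all add: field_simps flip: power_add)
      then have "(x ^ 4 + 1 / x ^ 13) * (x ^ 16 + 1 / x ^ 52) = trinomial x + 1 / x ^ 65"
        by (simp add: distrib_left distrib_right add_divide_distrib trinomial_eq add_ac flip: power_add)
      then show ?thesis
        by (simp only: mult.assoc[symmetric]) (simp add: distrib_right)
    qed
    ultimately show ?thesis
      by (simp only: distrib_left add_ac add_self add_self_left add_0_left add_0_right)
  qed
  ultimately show ?thesis by (simp add: v \<Psi>_def \<Phi>_def two_eq_0)
qed

lemma \<Psi>_odd_order:
  assumes "x \<noteq> 0" "full_kernel (trinomial x) = {0}"
  obtains n where "odd n" "\<Psi> x ^^ n = id"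
proof (rule odd_order_of_no_fixed_vector[of "\<Psi> x"])
  show "\<Psi> x (v + w) = \<Psi> x v + \<Psi> x w" for v w
    by (simp add: \<Psi>_def add_powers add_divide_distrib algebra_simps)
  show "\<Psi> x (scale c v) = scale (c ^ 4) (\<Psi> x v)" for c v
    by (simp add: \<Psi>_def scale_def power_mult_distrib algebra_simps)
  show "v = 0" if "\<Psi> x v = 0" for v
  proof -
    have "\<Phi> (trinomial x) v = \<Psi> x 0" using \<Psi>_square[OF assms(1), of v] that by simp
    then show ?thesis by (auto simp: \<Phi>_def \<Psi>_def prod_eq_iff)
  qed
  show "v = 0" if "\<Psi> x v = v" for v
  proof -
    obtain a b where v: "v = (a, b)" by fastforce
    have "\<Phi> (trinomial x) v = v" using \<Psi>_square[OF assms(1), of v] that by simp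
    then have "(b ^ 16, a ^ 16 + trinomial x * b ^ 16) = (a, b)"
      by (simp only: v \<Phi>_def fst_conv snd_conv)
    then have a: "a = b ^ 16" and b: "a ^ 16 + trinomial x * b ^ 16 = b"
      by (blast elim: Pair_inject)+
    have "b ^ 256 = a ^ 16" by (simp add: a flip: power_mult)
    then have "b ^ 256 + trinomial x * b ^ 16 = b" using b by simp
    then have "b \<in> full_kernel (trinomial x)"
      by (simp only: full_kernel_def mem_Collect_eq add_self)
    then show ?thesis using assms(2) a by (simp add: v zero_prod_def)
  qed
qed (rule that)

text \<open>
  A common odd multiple \<open>N\<close> of the orders of \<open>\<Psi> x\<close> and \<open>\<Psi> x'\<close> exhibits both as the same power
  \<open>(N + 1) / 2\<close> of their common square \<open>\<Phi> y\<close>, and \<open>\<Psi> x\<close> determines \<open>x\<close>.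
\<close>
lemma trinomial_inj_on_trivial_kernel:
  assumes "x \<noteq> 0" "x' \<noteq> 0" "trinomial x = y" "trinomial x' = y" "full_kernel y = {0}"
  shows "x = x'"
proof -
  have half: "\<Psi> z = \<Phi> y ^^ k"
    if "z \<noteq> 0" "trinomial z = y" "\<Psi> z ^^ n = id" "n dvd N" "Suc N = 2 * k" for z n N k
  proof -
    have "\<Psi> z ^^ N = id"
      using that(3,4) by (metis dvdE funpow_mult id_funpow)
    then have "\<Psi> z = \<Psi> z ^^ (2 * k)" by (simp flip: that(5))
    also have "\<dots> = (\<Psi> z ^^ 2) ^^ k" by (simp only: funpow_mult mult.commute)
    also have "\<Psi> z ^^ 2 = \<Phi> y"
      using \<Psi>_square[OF that(1)] that(2) by (simp add: fun_eq_iff eval_nat_numeral)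
    finally show ?thesis .
  qed
  obtain n n' where n: "odd n" "\<Psi> x ^^ n = id" and n': "odd n'" "\<Psi> x' ^^ n' = id"
    using \<Psi>_odd_order assms by metis
  have "even (Suc (n * n'))" using n n' by simp
  then obtain k where k: "Suc (n * n') = 2 * k" by blast
  have "\<Psi> x = \<Psi> x'"
    using half[OF _ _ n(2) _ k] half[OF _ _ n'(2) _ k] assms by simp
  then have "snd (\<Psi> x (1, 0)) = snd (\<Psi> x' (1, 0))" by simp
  then show ?thesis using assms by (simp add: \<Psi>_def)
qed

section \<open>The size of every fibre\<close>

text \<open>
  The right-hand side bounds the fibre size in each case. Its sum over \<open>y\<close> is
  \<open>(2 * 2 ^ m - 1) - 2 * 2 ^ (m - 1) = 2 ^ m - 1\<close>, which is also the sum of the fibre sizes, so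
  equality holds for every \<open>y\<close>.
\<close>
lemma card_nonzero_preimage:
  "card {x. x \<noteq> 0 \<and> trinomial x = y} =
    (if card (full_kernel y) = 2 then 0 else card (full_kernel y))"
proof -
  define n where "n y = card {x::'a. x \<noteq> 0 \<and> trinomial x = y}" for y
  define b where "b y = (if card (full_kernel y) = 2 then 0 else card (full_kernel y))" for y
  have le: "n y \<le> b y" for y
  proof (rule card_full_kernel_cases[of y])
    assume y: "full_kernel y = {0}"
    have "card {x. x \<noteq> 0 \<and> trinomial x = y} \<le> 1"
      using trinomial_inj_on_trivial_kernel y by (auto simp: card_le_Suc0_iff_eq)
    then show ?thesis using y by (simp add: n_def b_def)
  next
    assume y: "card (full_kernel y) = 2"
    then have "{x. x \<noteq> 0 \<and> trinomial x = y} = {}"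
      using card_full_kernel_trinomial_neq_2 by auto
    then show ?thesis by (simp only: n_def card.empty le0)
  next
    assume "card (full_kernel y) = 4"
    then show ?thesis using card_preimage_le_4[of y] by (simp add: n_def b_def)
  qed
  have "(\<Sum>y\<in>UNIV. n y) = 2 ^ m - 1"
  proof -
    have "(\<Sum>y\<in>UNIV. n y) = card (- {0::'a})"
      using sum.group[of "- {0::'a}" UNIV trinomial "\<lambda>_. 1::nat"] by (simp add: n_def)
    then show ?thesis by (simp add: Compl_eq_Diff_UNIV card_Diff_subset card_field)
  qed
  moreover have "(\<Sum>y\<in>UNIV. b y) + 2 ^ m = (\<Sum>y\<in>UNIV. card (full_kernel y))"
  proof -
    have "(\<Sum>y\<in>UNIV. if card (full_kernel y) = 2 then 2 else 0 :: nat)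
        = 2 * card {y. card (full_kernel y) = 2}"
      by (simp flip: sum.inter_filter)
    also have "\<dots> = 2 ^ m"
      using odd_pos[OF odd_degree] by (simp add: card_full_kernel_eq_2 flip: power_Suc)
    finally have "(\<Sum>y\<in>UNIV. b y) + 2 ^ m
        = (\<Sum>y\<in>UNIV. b y + (if card (full_kernel y) = 2 then 2 else 0))"
      by (simp only: sum.distrib)
    also have "\<dots> = (\<Sum>y\<in>UNIV. card (full_kernel y))"
      by (rule sum.cong) (simp_all add: b_def)
    finally show ?thesis .
  qed
  ultimately have "(\<Sum>y\<in>UNIV. n y) = (\<Sum>y\<in>UNIV. b y)"
    using sum_card_full_kernel by simp
  from sum_mono_inv[OF this le, of y] show ?thesis
    by (simp add: n_def b_def)
qed

lemma card_full_kernel_0: "card (full_kernel 0) = 2"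
proof -
  have "z \<in> full_kernel 0 \<longleftrightarrow> z = 0 \<or> z = 1" for z
    using power_Suc_eq_self_imp[of 255 z] by (auto simp: full_kernel_def add_eq_0_iff_eq)
  then have "full_kernel 0 = {0, 1}" by blast
  then show ?thesis by simp
qed

lemma trinomial_0: "trinomial (0::'a) = 0"
  by (simp add: trinomial_def)

lemma zero_one_map_trinomial: "zero_one_map 4 (UNIV :: 'a set) UNIV trinomial"
proof -
  have "card {x. trinomial x = y} \<in> {0, 1, 4}" for y :: 'a
  proof (cases "y = 0")
    case True
    have "{x::'a. x \<noteq> 0 \<and> trinomial x = 0} = {}"
      using card_nonzero_preimage[of 0] card_full_kernel_0 by simp
    then have "{x::'a. trinomial x = 0} = {0}"
      using trinomial_0 by blast
    then show ?thesis using True by simp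
  next
    case False
    then have "{x. trinomial x = y} = {x. x \<noteq> 0 \<and> trinomial x = y}"
      using trinomial_0 by auto
    then show ?thesis
      using card_nonzero_preimage[of y] by (cases rule: card_full_kernel_cases[of y]) simp_all
  qed
  then show ?thesis by (simp add: zero_one_map_def)
qed

lemma card_D_star_trinomial: "card (D_star (trinomial :: 'a \<Rightarrow> 'a)) = 2 ^ (m - 1)"
proof -
  have "y \<in> D_star trinomial \<longleftrightarrow> card (full_kernel y) \<noteq> 2" for y :: 'a
  proof
    assume "y \<in> D_star trinomial"
    then show "card (full_kernel y) \<noteq> 2"
      using card_full_kernel_trinomial_neq_2 by (auto simp: D_star_def)
  next
    assume y: "card (full_kernel y) \<noteq> 2"
    then have "card {x. x \<noteq> 0 \<and> trinomial x = y} \<noteq> 0"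
      using card_nonzero_preimage[of y] by (cases rule: card_full_kernel_cases[of y]) simp_all
    then have "{x. x \<noteq> 0 \<and> trinomial x = y} \<noteq> {}" by auto
    moreover have "y \<noteq> 0" using y card_full_kernel_0 by auto
    ultimately show "y \<in> D_star trinomial" by (auto simp: D_star_def)
  qed
  then have "D_star trinomial = UNIV - {y::'a. card (full_kernel y) = 2}" by blast
  then have "card (D_star (trinomial :: 'a \<Rightarrow> 'a)) = 2 ^ m - 2 ^ (m - 1)"
    by (simp add: card_Diff_subset card_field card_full_kernel_eq_2)
  also have "(2::nat) ^ m = 2 * 2 ^ (m - 1)"
    using odd_pos[OF odd_degree] by (simp flip: power_Suc)
  finally show ?thesis by simp
qed

end

theorem theorem19:
  fixes m :: nat
  assumes "odd m"
    and "CARD('a::{field,finite}) = 2 ^ m"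
  shows "zero_one_map 4 (UNIV :: 'a set) (UNIV :: 'a set) trinomial \<and>
         card (D_star (trinomial :: 'a \<Rightarrow> 'a)) = 2 ^ (m - 1)"
proof -
  interpret odd_degree_binary_field "TYPE('a)" m
    by standard (use assms in auto)
  show ?thesis
    using zero_one_map_trinomial card_D_star_trinomial by blast
qed

end
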